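(* Let $\mathcal{G}$ be a finite simple graph with $|e(\mathcal{G})|$ edges. Then $E_{CN}(\mathcal{G})\le E(\mathcal{G})^2+2|e(\mathcal{G})|$.
   Context: $E(\mathcal{G})$ is the sum of the absolute values of the eigenvalues of the adjacency matrix of $\mathcal{G}$. For vertices $v_1,\dots,v_p$ of $\mathcal{G}$, $\mathrm{CN}(\mathcal{G})$ is the matrix with $(i,j)$-entry $|N(v_i)\cap N(v_j)|$ for $i\neq j$ (open neighbourhoods) and $0$ on the diagonal, and $E_{CN}(\mathcal{G})$ is the sum of the absolute values of the eigenvalues of $\mathrm{CN}(\mathcal{G})$. *)

theory Defs
  imports "Jordan_Normal_Form.Spectral_Radius"
begin

definition simple_graph :: "'a set \<Rightarrow> 'a set set \<Rightarrow> bool" where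
  "simple_graph V E \<longleftrightarrow> finite V \<and> (\<forall>e\<in>E. e \<subseteq> V \<and> card e = 2)"

definition neighbourhood :: "'a set set \<Rightarrow> 'a \<Rightarrow> 'a set" where
  "neighbourhood E v = {u. {v, u} \<in> E}"

text \<open>
  The list \<open>vs\<close> below enumerates the vertices, without repetition; the vertex with index
  \<open>i\<close> is \<open>vs ! i\<close>. Another enumeration conjugates both matrices by a permutation matrix.
\<close>

definition adjacency_matrix :: "'a set set \<Rightarrow> 'a list \<Rightarrow> real mat" where
  "adjacency_matrix E vs = mat (length vs) (length vs)
     (\<lambda>(i, j). if {vs ! i, vs ! j} \<in> E then 1 else 0)"

definition common_neighbourhood_matrix :: "'a set set \<Rightarrow> 'a list \<Rightarrow> real mat" where
  "common_neighbourhood_matrix E vs = mat (length vs) (length vs)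
     (\<lambda>(i, j). if i = j then 0
               else real (card (neighbourhood E (vs ! i) \<inter> neighbourhood E (vs ! j))))"

text \<open>
  Eigenvalues are counted with algebraic multiplicity, i.e. their order as roots of the
  characteristic polynomial. They are taken over the complex numbers, so that no eigenvalue
  is lost by definition; for the symmetric matrices above they are all real.
\<close>

definition matrix_energy :: "real mat \<Rightarrow> real" where
  "matrix_energy A = (let C = map_mat complex_of_real A in
     \<Sum>k\<in>spectrum C. real (order k (char_poly C)) * cmod k)"

definition graph_energy :: "'a set set \<Rightarrow> 'a list \<Rightarrow> real" where
  "graph_energy E vs = matrix_energy (adjacency_matrix E vs)"

definition cn_energy :: "'a set set \<Rightarrow> 'a list \<Rightarrow> real" where
  "cn_energy E vs = matrix_energy (common_neighbourhood_matrix E vs)"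

end

(*
  Let A be the adjacency matrix, D the diagonal matrix of degrees and e the number of edges. Then
  CN = A^T A - D with D = Z^T Z for Z = diag(sqrt(deg)). Take a unitary P for which P^* CN P is upper
  triangular. Its i-th diagonal entry is |A p_i|^2 - |Z p_i|^2 (p_i the i-th column of P), so summing
  absolute values gives E_CN <= tr(A^T A) + tr D = 4e. On the other hand
  E^2 = (sum |l_i|)^2 >= |sum l_i^2| = |tr(A^2)| = 2e. Schur triangularization suffices: the spectral
  theorem for symmetric matrices is not required.
*)
theory Submission
  imports Defs
begin

section \<open>Adjoints, Gram matrices and traces\<close>

definition adjoint_mat :: "complex mat \<Rightarrow> complex mat" where
  "adjoint_mat A = map_mat cnj (transpose_mat A)"

definition mat_trace :: "'a::comm_monoid_add mat \<Rightarrow> 'a" where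
  "mat_trace A = (\<Sum>i<dim_row A. A $$ (i, i))"

lemma adjoint_mat_carrier [simp, intro]:
  "A \<in> carrier_mat n m \<Longrightarrow> adjoint_mat A \<in> carrier_mat m n"
  by (simp add: adjoint_mat_def)

lemma dim_adjoint_mat [simp]:
  "dim_row (adjoint_mat A) = dim_col A" "dim_col (adjoint_mat A) = dim_row A"
  by (simp_all add: adjoint_mat_def)

lemma index_adjoint_mat [simp]:
  "i < dim_col A \<Longrightarrow> j < dim_row A \<Longrightarrow> adjoint_mat A $$ (i, j) = cnj (A $$ (j, i))"
  by (simp add: adjoint_mat_def)

lemma index_mult_mat_sum:
  assumes "A \<in> carrier_mat n m" "B \<in> carrier_mat m k" "i < n" "j < k"
  shows "(A * B) $$ (i, j) = (\<Sum>l<m. A $$ (i, l) * B $$ (l, j))"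
  using assms by (auto simp: scalar_prod_def atLeast0LessThan intro!: sum.cong)

lemma adjoint_mat_mult:
  assumes "A \<in> carrier_mat n m" "B \<in> carrier_mat m k"
  shows "adjoint_mat (A * B) = adjoint_mat B * adjoint_mat A"
proof (rule eq_matI)
  fix i j assume "i < dim_row (adjoint_mat B * adjoint_mat A)"
    "j < dim_col (adjoint_mat B * adjoint_mat A)"
  then have ij: "i < k" "j < n" using assms by auto
  have "adjoint_mat (A * B) $$ (i, j) = cnj (\<Sum>l<m. A $$ (j, l) * B $$ (l, i))"
    using assms ij by (simp add: index_mult_mat_sum[OF assms] del: index_mult_mat(1))
  also have "\<dots> = (\<Sum>l<m. adjoint_mat B $$ (i, l) * adjoint_mat A $$ (l, j))"
    using assms ij by (auto simp: mult.commute intro!: sum.cong)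
  also have "\<dots> = (adjoint_mat B * adjoint_mat A) $$ (i, j)"
    using assms ij by (subst index_mult_mat_sum[of _ k m _ n]) auto
  finally show "adjoint_mat (A * B) $$ (i, j) = (adjoint_mat B * adjoint_mat A) $$ (i, j)" .
qed (use assms in auto)

text \<open>The entry is the inner product of column \<open>i\<close> with itself, hence real and
  nonnegative. All sign information in the bound for differences of Gram matrices comes from
  here.\<close>

lemma adjoint_gram_diagonal:
  assumes "A \<in> carrier_mat n m" "i < m"
  shows "(adjoint_mat A * A) $$ (i, i) = of_real (\<Sum>k<n. (cmod (A $$ (k, i)))\<^sup>2)"
  using assms
  by (subst index_mult_mat_sum[of _ m n _ m])
    (auto simp: complex_norm_square mult.commute simp del: of_real_power intro!: sum.cong)

lemma trace_mult_commute:
  fixes A :: "'a::comm_semiring_0 mat"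
  assumes "A \<in> carrier_mat n m" "B \<in> carrier_mat m n"
  shows "mat_trace (A * B) = mat_trace (B * A)"
proof -
  have "mat_trace (A * B) = (\<Sum>i<n. \<Sum>l<m. A $$ (i, l) * B $$ (l, i))"
    using assms unfolding mat_trace_def
    by (auto simp: index_mult_mat_sum[of A n m B n] simp del: index_mult_mat(1) intro!: sum.cong)
  also have "\<dots> = (\<Sum>l<m. \<Sum>i<n. B $$ (l, i) * A $$ (i, l))"
    by (subst sum.swap) (simp add: mult.commute)
  also have "\<dots> = mat_trace (B * A)"
    using assms unfolding mat_trace_def
    by (auto simp: index_mult_mat_sum[of B m n A m] simp del: index_mult_mat(1) intro!: sum.cong)
  finally show ?thesis .
qed

text \<open>Cyclicity of the trace moves \<open>P\<close> to the front, where it meets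
  \<open>Q\<close> and cancels.\<close>

lemma trace_conjugate:
  fixes A :: "'a::comm_semiring_1 mat"
  assumes "A \<in> carrier_mat n n" "P \<in> carrier_mat n n" "Q \<in> carrier_mat n n" "P * Q = 1\<^sub>m n"
  shows "mat_trace (Q * A * P) = mat_trace A"
proof -
  have "mat_trace (Q * A * P) = mat_trace (P * (Q * A))"
    using assms by (intro trace_mult_commute[of _ n n]) auto
  also have "P * (Q * A) = A"
    using assms by (simp flip: assoc_mult_mat[of P n n Q n A n])
  finally show ?thesis .
qed

section \<open>Unitary triangularization of complex matrices\<close>

text \<open>Complete \<open>v\<close> to a basis, orthogonalize it by Gram-Schmidt, which keeps its
  head, and normalize. Later \<open>v\<close> is an eigenvector, so the scalar \<open>c\<close> may
  stay unspecified.\<close>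

lemma unitary_with_first_column:
  fixes v :: "complex vec"
  assumes v: "v \<in> carrier_vec n" "v \<noteq> 0\<^sub>v n" and n: "n > 0"
  obtains U c where "U \<in> carrier_mat n n" "adjoint_mat U * U = 1\<^sub>m n" "col U 0 = c \<cdot>\<^sub>v v"
proof -
  interpret cof_vec_space n "TYPE(complex)" .
  define b where "b = basis_completion v"
  define ws where "ws = gram_schmidt n b"
  from basis_completion[OF v, folded b_def]
  have dist_b: "distinct b" and indep: "\<not> lin_dep (set b)" and b: "set b \<subseteq> carrier_vec n"
    and hdb: "hd b = v" and len_b: "length b = n" by auto
  from hdb len_b n obtain vs where bv: "b = v # vs" by (cases b) auto
  from gram_schmidt_result[OF b dist_b indep refl, folded ws_def]
  have ws: "set ws \<subseteq> carrier_vec n" "corthogonal ws" "length ws = n"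
    by (auto simp: len_b)
  from gram_schmidt_hd[OF v(1), of vs, folded bv] have hdws: "hd ws = v" unfolding ws_def .
  have ws0: "ws ! 0 = v" using hdws ws(3) n by (cases ws) auto
  have wsc: "ws ! j \<in> carrier_vec n" if "j < n" for j using ws that by (auto simp: subset_iff)
  \<comment> \<open>The vectors \<open>ws\<close> are orthogonal but not normalized;
    \<open>r j\<close> is the Euclidean norm of \<open>ws ! j\<close>, by which column
    \<open>j\<close> of \<open>U\<close> is divided.\<close>
  define r where "r j = sqrt (\<Sum>k<n. (cmod (ws ! j $ k))\<^sup>2)" for j
  define U where "U = mat n n (\<lambda>(i, j). ws ! j $ i / complex_of_real (r j))"
  have sprod: "ws ! j \<bullet>c ws ! i = (\<Sum>k<n. cnj (ws ! i $ k) * ws ! j $ k)" if "i < n" "j < n" for i j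
    using wsc[OF that(1)] wsc[OF that(2)]
    by (auto simp: scalar_prod_def atLeast0LessThan mult.commute conjugate_complex_def intro!: sum.cong)
  have rsq: "(\<Sum>k<n. cnj (ws ! j $ k) * ws ! j $ k) = complex_of_real (r j) * complex_of_real (r j)"
    for j
  proof -
    have "complex_of_real (r j) * complex_of_real (r j) = of_real ((r j)\<^sup>2)"
      by (simp add: power2_eq_square)
    also have "(r j)\<^sup>2 = (\<Sum>k<n. (cmod (ws ! j $ k))\<^sup>2)"
      unfolding r_def by (simp add: sum_nonneg)
    finally show ?thesis
      by (simp add: complex_norm_square mult.commute del: of_real_power)
  qed
  have UU: "adjoint_mat U * U = 1\<^sub>m n"
  proof (rule eq_matI)
    fix i j assume "i < dim_row (1\<^sub>m n :: complex mat)" "j < dim_col (1\<^sub>m n :: complex mat)"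
    then have ij: "i < n" "j < n" by auto
    have "(adjoint_mat U * U) $$ (i, j)
      = (\<Sum>k<n. cnj (ws ! i $ k) * ws ! j $ k) / (complex_of_real (r i) * complex_of_real (r j))"
      using ij by (subst index_mult_mat_sum[of _ n n _ n])
        (auto simp: U_def sum_divide_distrib intro!: sum.cong)
    \<comment> \<open>Off the diagonal the numerator vanishes by orthogonality. On it,
      \<open>corthogonalD\<close> says that the product of \<open>ws ! i\<close> with itself is
      nonzero, so by \<open>rsq\<close> numerator and denominator are the same nonzero
      number.\<close>
    also have "\<dots> = (1\<^sub>m n) $$ (i, j)"
      using ws(2,3) ij corthogonalD[OF ws(2), of j i] sprod[of i j] rsq[of i]
      by (cases "i = j") auto
    finally show "(adjoint_mat U * U) $$ (i, j) = (1\<^sub>m n) $$ (i, j)" .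
  qed (auto simp: U_def)
  have "col U 0 = (1 / complex_of_real (r 0)) \<cdot>\<^sub>v v"
    using v n by (intro eq_vecI) (auto simp: U_def ws0)
  with UU show thesis by (intro that[of U]) (auto simp: U_def)
qed

lemma adjoint_mat_four_block_one:
  assumes "P \<in> carrier_mat m m"
  shows "adjoint_mat (four_block_mat (1\<^sub>m 1) (0\<^sub>m 1 m) (0\<^sub>m m 1) P)
    = four_block_mat (1\<^sub>m 1) (0\<^sub>m 1 m) (0\<^sub>m m 1) (adjoint_mat P)"
  using assms by (intro eq_matI) auto

text \<open>Deflation: a unitary matrix whose first column is an eigenvector clears the first column
  below the diagonal, and the induction hypothesis handles the remaining block. Unitarity, and not
  just invertibility, makes a conjugated Gram matrix a Gram matrix again.\<close>

lemma unitary_schur: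
  assumes "A \<in> carrier_mat n n"
  shows "\<exists>P \<in> carrier_mat n n. adjoint_mat P * P = 1\<^sub>m n \<and> upper_triangular (adjoint_mat P * A * P)"
  using assms
proof (induction n arbitrary: A)
  case 0
  then show ?case by (intro bexI[of _ "1\<^sub>m 0"]) auto
next
  case (Suc m)
  note A = Suc.prems
  from spectrum_non_empty[OF A] obtain e v where ev: "eigenvector A v e"
    by (auto simp: spectrum_def eigenvalue_def)
  then have v: "v \<in> carrier_vec (Suc m)" "v \<noteq> 0\<^sub>v (Suc m)" "A *\<^sub>v v = e \<cdot>\<^sub>v v"
    using A by (auto simp: eigenvector_def)
  from unitary_with_first_column[OF v(1,2)] obtain U c where
    U: "U \<in> carrier_mat (Suc m) (Suc m)" "adjoint_mat U * U = 1\<^sub>m (Suc m)" "col U 0 = c \<cdot>\<^sub>v v"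
    by auto
  define T where "T = adjoint_mat U * A * U"
  have aU: "adjoint_mat U \<in> carrier_mat (Suc m) (Suc m)" using U by auto
  have T: "T \<in> carrier_mat (Suc m) (Suc m)" using U A by (auto simp: T_def)
  \<comment> \<open>\<open>col U 0\<close> is a multiple of \<open>v\<close>, so \<open>A\<close>
    acts on it as \<open>e\<close>; then \<open>adjoint_mat U\<close> sends it to the first column
    of the identity.\<close>
  have T0: "T $$ (i, 0) = (if i = 0 then e else 0)" if "i < Suc m" for i
  proof -
    have "T = adjoint_mat U * (A * U)" unfolding T_def by (rule assoc_mult_mat[OF aU A U(1)])
    then have "T $$ (i, 0) = row (adjoint_mat U) i \<bullet> col (A * U) 0"
      using that U A by auto
    also have "col (A * U) 0 = A *\<^sub>v col U 0" using A U by auto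
    also have "\<dots> = e \<cdot>\<^sub>v col U 0"
      using v A U by (simp add: mult_mat_vec smult_smult_assoc mult.commute)
    also have "row (adjoint_mat U) i \<bullet> (e \<cdot>\<^sub>v col U 0) = e * (row (adjoint_mat U) i \<bullet> col U 0)"
      using row_carrier_vec[of i "Suc m" _ "Suc m"] col_carrier_vec[of 0 "Suc m" _ "Suc m"] that aU U(1)
      by (intro scalar_prod_smult_distrib[of _ "Suc m"]) blast+
    also have "row (adjoint_mat U) i \<bullet> col U 0 = (adjoint_mat U * U) $$ (i, 0)"
      using that U(1) by auto
    finally show ?thesis using that by (simp add: U(2))
  qed
  define B where "B = mat 1 m (\<lambda>(i, j). T $$ (i, Suc j))"
  define D where "D = mat m m (\<lambda>(i, j). T $$ (Suc i, Suc j))"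
  let ?e = "mat 1 1 (\<lambda>_. e)"
  have B: "B \<in> carrier_mat 1 m" and D: "D \<in> carrier_mat m m" by (auto simp: B_def D_def)
  have Tblock: "T = four_block_mat ?e B (0\<^sub>m m 1) D"
    using T T0 by (intro eq_matI) (auto simp: B_def D_def)
  from Suc.IH[OF D] obtain P where P: "P \<in> carrier_mat m m" "adjoint_mat P * P = 1\<^sub>m m"
    "upper_triangular (adjoint_mat P * D * P)" by auto
  \<comment> \<open>Bordering \<open>P\<close> by a 1 keeps the zeros in the first column of
    \<open>T\<close> while conjugating the block \<open>D\<close> by \<open>P\<close>.\<close>
  define F where "F = four_block_mat (1\<^sub>m 1) (0\<^sub>m 1 m) (0\<^sub>m m 1) P"
  have F: "F \<in> carrier_mat (Suc m) (Suc m)" using P by (auto simp: F_def)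
  have aF: "adjoint_mat F \<in> carrier_mat (Suc m) (Suc m)" using F by auto
  have aFb: "adjoint_mat F = four_block_mat (1\<^sub>m 1) (0\<^sub>m 1 m) (0\<^sub>m m 1) (adjoint_mat P)"
    unfolding F_def by (rule adjoint_mat_four_block_one[OF P(1)])
  have aP: "adjoint_mat P \<in> carrier_mat m m" using P by auto
  have FF: "adjoint_mat F * F = 1\<^sub>m (Suc m)"
    unfolding aFb unfolding F_def
    by (subst mult_four_block_mat[of _ 1 1 _ m _ m _ _ 1 _ m]) (use P aP in auto)
  have FTF: "adjoint_mat F * T * F = four_block_mat ?e (B * P) (0\<^sub>m m 1) (adjoint_mat P * D * P)"
    unfolding aFb Tblock unfolding F_def using P aP B D
    by (subst mult_four_block_mat[of _ 1 1 _ m _ m _ _ 1 _ m],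
        auto simp: left_add_zero_mat[of _ m m] mult_carrier_mat[of _ m m _ m])+
  define W where "W = U * F"
  have W: "W \<in> carrier_mat (Suc m) (Suc m)" using U F by (auto simp: W_def)
  have aW: "adjoint_mat W = adjoint_mat F * adjoint_mat U"
    unfolding W_def using U F by (intro adjoint_mat_mult) auto
  \<comment> \<open>Stated for every \<open>X\<close>, since it is used twice: the identity matrix
    gives unitarity of \<open>W\<close>, and \<open>A\<close> gives triangularity.\<close>
  have conj: "adjoint_mat W * X * W = adjoint_mat F * (adjoint_mat U * X * U) * F"
    if X: "X \<in> carrier_mat (Suc m) (Suc m)" for X
    unfolding aW unfolding W_def using X U(1) F aF aU
    by (simp add: assoc_mult_mat[of _ "Suc m" "Suc m" _ "Suc m" _ "Suc m"]
        mult_carrier_mat[of _ "Suc m" "Suc m" _ "Suc m"])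
  have "adjoint_mat W * W = 1\<^sub>m (Suc m)"
    using conj[of "1\<^sub>m (Suc m)"] W U FF F aU aF by auto
  moreover have "upper_triangular (adjoint_mat W * A * W)"
    unfolding conj[OF A] T_def[symmetric] FTF
  proof (rule upper_triangular_four_block[of _ 1 _ m])
    show "adjoint_mat P * D * P \<in> carrier_mat m m" using P(1) aP D by auto
  qed (use P(3) in auto)
  ultimately show ?case using W by auto
qed

section \<open>Matrix energy read off a triangular form\<close>

text \<open>The order of the product at \<open>k\<close> counts how often \<open>k\<close> occurs in
  \<open>as\<close>, so multiplicities become repetitions in the list. Elements of \<open>S\<close>
  outside the list have order 0; allowing them lets \<open>S\<close> stay fixed while the induction
  shortens the list.\<close>

lemma sum_order_eq_sum_list:
  fixes f :: "'a::field \<Rightarrow> real"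
  assumes "finite S" "set as \<subseteq> S"
  shows "(\<Sum>k\<in>S. real (order k (\<Prod>a\<leftarrow>as. [:- a, 1:])) * f k) = sum_list (map f as)"
  using assms(2)
proof (induction as)
  case Nil
  then show ?case by (simp add: order_0I)
next
  case (Cons a as)
  have nz: "(\<Prod>a\<leftarrow>as. [:- a, 1:]) \<noteq> (0 :: 'a poly)"
    by (auto simp: prod_list_zero_iff)
  have lin: "order k [:- a, 1:] = (if k = a then 1 else 0)" for k
    by (auto simp: order_linear')
  have "order k (\<Prod>a\<leftarrow>a # as. [:- a, 1:]) = (if k = a then 1 else 0) + order k (\<Prod>a\<leftarrow>as. [:- a, 1:])" for k
    using nz by (simp add: order_mult lin del: mult_pCons_left mult_pCons_right)
  then have "(\<Sum>k\<in>S. real (order k (\<Prod>a\<leftarrow>a # as. [:- a, 1:])) * f k)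
    = (\<Sum>k\<in>S. (if k = a then f k else 0) + real (order k (\<Prod>a\<leftarrow>as. [:- a, 1:])) * f k)"
    by (intro sum.cong) (auto simp: algebra_simps)
  also have "\<dots> = f a + sum_list (map f as)"
    using Cons assms(1) by (simp add: sum.distrib)
  finally show ?case by simp
qed

text \<open>Similar matrices share their characteristic polynomial, and that of a triangular matrix
  splits over its diagonal. The diagonal thus lists the eigenvalues with algebraic multiplicity.
  \<open>P\<close> is returned as well, because the bounds below analyse the diagonal through
  it.\<close>

lemma matrix_energy_schur:
  assumes A: "A \<in> carrier_mat n n"
  obtains P where "P \<in> carrier_mat n n" "adjoint_mat P * P = 1\<^sub>m n" "P * adjoint_mat P = 1\<^sub>m n"
    "upper_triangular (adjoint_mat P * map_mat complex_of_real A * P)"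
    "matrix_energy A = (\<Sum>i<n. cmod ((adjoint_mat P * map_mat complex_of_real A * P) $$ (i, i)))"
proof -
  let ?C = "map_mat complex_of_real A"
  have C: "?C \<in> carrier_mat n n" using A by auto
  from unitary_schur[OF C] obtain P where P: "P \<in> carrier_mat n n" "adjoint_mat P * P = 1\<^sub>m n"
    and ut: "upper_triangular (adjoint_mat P * ?C * P)" by auto
  let ?T = "adjoint_mat P * ?C * P"
  have aP: "adjoint_mat P \<in> carrier_mat n n" using P by auto
  have PP: "P * adjoint_mat P = 1\<^sub>m n" by (rule mat_mult_left_right_inverse[OF aP P])
  have T: "?T \<in> carrier_mat n n" using P C by auto
  have "similar_mat_wit ?T ?C (adjoint_mat P) P"
    by (rule similar_mat_witI[OF P(2) PP refl T C aP P(1)])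
  then have "similar_mat ?T ?C" by (auto simp: similar_mat_def)
  then have cp: "char_poly ?C = (\<Prod>a\<leftarrow>diag_mat ?T. [:- a, 1:])"
    using char_poly_similar char_poly_upper_triangular[OF T ut] by metis
  have spec: "spectrum ?C = set (diag_mat ?T)"
    unfolding spectrum_root_char_poly[OF C] cp
    by (auto simp: poly_prod_list prod_list_zero_iff)
  have "matrix_energy A = sum_list (map cmod (diag_mat ?T))"
    unfolding matrix_energy_def Let_def spec cp by (rule sum_order_eq_sum_list) auto
  also have "\<dots> = (\<Sum>i<n. cmod (?T $$ (i, i)))"
    using P by (simp add: diag_mat_def o_def sum_list_distinct_conv_sum_set atLeast0LessThan)
  finally show thesis using that P PP ut by blast
qed

section \<open>Bounds between energies and traces\<close>

lemma of_real_mat_mult: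
  assumes "A \<in> carrier_mat n m" "B \<in> carrier_mat m k"
  shows "map_mat complex_of_real (A * B) = map_mat of_real A * map_mat of_real B"
  using of_real_hom.mat_hom_mult[OF assms] .

text \<open>\<open>P\<close> triangularizes the difference; the two conjugated Gram matrices are in
  general not triangular. Still, their diagonals are squared column norms and their traces are
  unchanged by the conjugation, which is what the estimate uses.\<close>

lemma matrix_energy_gram_diff_le:
  fixes Y Z :: "real mat"
  assumes Y: "Y \<in> carrier_mat n n" and Z: "Z \<in> carrier_mat n n"
  shows "matrix_energy (transpose_mat Y * Y - transpose_mat Z * Z)
    \<le> mat_trace (transpose_mat Y * Y) + mat_trace (transpose_mat Z * Z)"
proof -
  let ?c = "map_mat complex_of_real"
  let ?M = "transpose_mat Y * Y - transpose_mat Z * Z"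
  have M: "?M \<in> carrier_mat n n" using Y Z by auto
  obtain P where
    P: "P \<in> carrier_mat n n" "adjoint_mat P * P = 1\<^sub>m n" "P * adjoint_mat P = 1\<^sub>m n"
    "upper_triangular (adjoint_mat P * ?c ?M * P)" and
    en: "matrix_energy ?M = (\<Sum>i<n. cmod ((adjoint_mat P * ?c ?M * P) $$ (i, i)))"
    by (rule matrix_energy_schur[OF M])
  have aP: "adjoint_mat P \<in> carrier_mat n n" using P by auto
  have gram: "adjoint_mat P * ?c (transpose_mat X * X) * P = adjoint_mat (?c X * P) * (?c X * P)"
    and trace: "(\<Sum>i<n. \<Sum>k<n. (cmod ((?c X * P) $$ (k, i)))\<^sup>2) = mat_trace (transpose_mat X * X)"
    if X: "X \<in> carrier_mat n n" for X
  proof -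
    \<comment> \<open>The entries of \<open>X\<close> are real, so conjugating them changes
      nothing.\<close>
    have adj: "?c (transpose_mat X) = adjoint_mat (?c X)"
      using X by (intro eq_matI) auto
    have aX: "adjoint_mat (?c X) \<in> carrier_mat n n" and cX: "?c X \<in> carrier_mat n n" using X by auto
    have h: "?c (transpose_mat X * X) = adjoint_mat (?c X) * ?c X"
      using of_real_mat_mult[of "transpose_mat X" n n X n] X adj by auto
    show g: "adjoint_mat P * ?c (transpose_mat X * X) * P = adjoint_mat (?c X * P) * (?c X * P)"
      unfolding h adjoint_mat_mult[OF cX P(1)] using P(1) aP aX cX
      by (simp add: assoc_mult_mat[of _ n n _ n _ n] mult_carrier_mat[of _ n n _ n])
    have "complex_of_real (\<Sum>i<n. \<Sum>k<n. (cmod ((?c X * P) $$ (k, i)))\<^sup>2)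
      = (\<Sum>i<n. (adjoint_mat (?c X * P) * (?c X * P)) $$ (i, i))"
      unfolding of_real_sum using adjoint_gram_diagonal[of "?c X * P" n n] cX P(1)
      by (intro sum.cong) auto
    also have "\<dots> = mat_trace (adjoint_mat P * ?c (transpose_mat X * X) * P)"
      unfolding g using P(1) by (simp add: mat_trace_def)
    also have "\<dots> = mat_trace (?c (transpose_mat X * X))"
      using X P aP by (intro trace_conjugate[of _ n]) auto
    also have "\<dots> = complex_of_real (mat_trace (transpose_mat X * X))"
      using X by (simp add: mat_trace_def)
    finally show "(\<Sum>i<n. \<Sum>k<n. (cmod ((?c X * P) $$ (k, i)))\<^sup>2) = mat_trace (transpose_mat X * X)"
      using of_real_eq_iff by blast
  qed
  let ?n = "\<lambda>X i. \<Sum>k<n. (cmod ((?c X * P) $$ (k, i)))\<^sup>2"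
  have split: "adjoint_mat P * ?c ?M * P = adjoint_mat P * ?c (transpose_mat Y * Y) * P
      - adjoint_mat P * ?c (transpose_mat Z * Z) * P"
  proof -
    have cYZ: "?c (transpose_mat Y * Y) \<in> carrier_mat n n" "?c (transpose_mat Z * Z) \<in> carrier_mat n n"
      using Y Z by auto
    have "?c ?M = ?c (transpose_mat Y * Y) - ?c (transpose_mat Z * Z)"
      using Y Z by (intro eq_matI) auto
    then have "adjoint_mat P * ?c ?M = adjoint_mat P * ?c (transpose_mat Y * Y)
        - adjoint_mat P * ?c (transpose_mat Z * Z)"
      using mult_minus_distrib_mat[OF aP cYZ] by argo
    then show ?thesis
      using minus_mult_distrib_mat[OF mult_carrier_mat[OF aP cYZ(1)] mult_carrier_mat[OF aP cYZ(2)] P(1)]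
      by argo
  qed
  have "cmod ((adjoint_mat P * ?c ?M * P) $$ (i, i)) \<le> ?n Y i + ?n Z i" if "i < n" for i
  proof -
    have "(adjoint_mat P * ?c ?M * P) $$ (i, i) = of_real (?n Y i) - of_real (?n Z i)"
    proof -
      have YP: "?c Y * P \<in> carrier_mat n n" and ZP: "?c Z * P \<in> carrier_mat n n"
        using Y Z P(1) by auto
      show ?thesis
        unfolding split gram[OF Y] gram[OF Z] adjoint_gram_diagonal[OF YP that, symmetric]
          adjoint_gram_diagonal[OF ZP that, symmetric]
        by (rule index_minus_mat) (use that P(1) in simp_all)
    qed
    also have "cmod \<dots> = \<bar>?n Y i - ?n Z i\<bar>"
      by (simp only: norm_of_real flip: of_real_diff)
    also have "\<dots> \<le> ?n Y i + ?n Z i"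
    proof -
      have "?n Y i \<ge> 0" "?n Z i \<ge> 0" by (auto intro!: sum_nonneg)
      then show ?thesis by linarith
    qed
    finally show ?thesis .
  qed
  then have "matrix_energy ?M \<le> (\<Sum>i<n. ?n Y i + ?n Z i)"
    unfolding en by (intro sum_mono) auto
  then show ?thesis using trace[OF Y] trace[OF Z] by (simp add: sum.distrib)
qed

text \<open>The trace of the square is the sum of the squared eigenvalues. These may be non-real
  here, so moduli are taken first; then a sum of squares of nonnegative numbers is at most the
  square of their sum.\<close>

lemma trace_square_le_matrix_energy:
  fixes A :: "real mat"
  assumes A: "A \<in> carrier_mat n n"
  shows "mat_trace (A * A) \<le> (matrix_energy A)\<^sup>2"
proof -
  let ?c = "map_mat complex_of_real"
  obtain P where
    P: "P \<in> carrier_mat n n" "adjoint_mat P * P = 1\<^sub>m n" "P * adjoint_mat P = 1\<^sub>m n" and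
    ut: "upper_triangular (adjoint_mat P * ?c A * P)" and
    en: "matrix_energy A = (\<Sum>i<n. cmod ((adjoint_mat P * ?c A * P) $$ (i, i)))"
    by (rule matrix_energy_schur[OF A])
  have aP: "adjoint_mat P \<in> carrier_mat n n" using P by auto
  have cA: "?c A \<in> carrier_mat n n" using A by auto
  define T where "T = adjoint_mat P * ?c A * P"
  have T: "T \<in> carrier_mat n n" using P cA by (auto simp: T_def)
  \<comment> \<open>The factor \<open>P * adjoint_mat P\<close> in the middle of
    \<open>T * T\<close> collapses to the identity, so \<open>T * T\<close> is the conjugate of the
    square of \<open>A\<close>.\<close>
  have "T * T = adjoint_mat P * (?c A * ((P * adjoint_mat P) * (?c A * P)))"
    unfolding T_def using P(1) aP cA by (simp add: assoc_mult_mat[of _ n n _ n _ n] mult_carrier_mat[of _ n n _ n])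
  then have TT: "adjoint_mat P * ?c (A * A) * P = T * T"
    unfolding P(3) of_real_mat_mult[OF A A]
    using P(1) aP cA by (simp add: assoc_mult_mat[of _ n n _ n _ n] mult_carrier_mat[of _ n n _ n])
  have diag: "(T * T) $$ (i, i) = (T $$ (i, i))\<^sup>2" if "i < n" for i
  proof -
    have "(T * T) $$ (i, i) = (\<Sum>l<n. T $$ (i, l) * T $$ (l, i))"
      by (rule index_mult_mat_sum[OF T T that that])
    \<comment> \<open>For \<open>l \<noteq> i\<close> one of \<open>T $$ (i, l)\<close> and
      \<open>T $$ (l, i)\<close> lies below the diagonal and is zero.\<close>
    also have "\<dots> = (\<Sum>l<n. if l = i then (T $$ (i, i))\<^sup>2 else 0)"
      using ut[folded T_def] T that
      by (intro sum.cong) (auto simp: power2_eq_square upper_triangular_def neq_iff)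
    finally show ?thesis using that by simp
  qed
  have "complex_of_real (mat_trace (A * A)) = mat_trace (?c (A * A))"
    using A by (simp add: mat_trace_def)
  also have "\<dots> = mat_trace (adjoint_mat P * ?c (A * A) * P)"
    using A P aP by (intro trace_conjugate[of _ n, symmetric]) auto
  also have "\<dots> = (\<Sum>i<n. (T $$ (i, i))\<^sup>2)"
    unfolding TT mat_trace_def using T diag by (intro sum.cong) auto
  finally have "complex_of_real (mat_trace (A * A)) = (\<Sum>i<n. (T $$ (i, i))\<^sup>2)" .
  then have "\<bar>mat_trace (A * A)\<bar> = cmod (\<Sum>i<n. (T $$ (i, i))\<^sup>2)"
    by (metis norm_of_real real_norm_def)
  also have "\<dots> \<le> (\<Sum>i<n. (cmod (T $$ (i, i)))\<^sup>2)"
    by (rule order_trans[OF norm_sum]) (simp add: norm_power)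
  also have "\<dots> \<le> (\<Sum>i<n. cmod (T $$ (i, i)))\<^sup>2"
  proof -
    let ?t = "\<lambda>i. cmod (T $$ (i, i))"
    \<comment> \<open>One factor of each square is enlarged to the whole sum, which is at least each
      of its nonnegative terms.\<close>
    have "(\<Sum>i<n. (?t i)\<^sup>2) \<le> (\<Sum>i<n. ?t i * (\<Sum>j<n. ?t j))"
      by (intro sum_mono)
        (auto simp: power2_eq_square intro!: mult_left_mono member_le_sum)
    then show ?thesis by (simp add: power2_eq_square sum_distrib_right)
  qed
  finally show ?thesis unfolding en T_def by linarith
qed

section \<open>Degrees and common neighbours in a graph\<close>

lemma neighbourhood_subset:
  assumes "simple_graph V E" shows "neighbourhood E v \<subseteq> V"
  using assms by (fastforce simp: simple_graph_def neighbourhood_def)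

text \<open>The handshake lemma, by counting incident pairs of a vertex and an edge in two
  ways.\<close>

lemma sum_degrees:
  assumes g: "simple_graph V E"
  shows "(\<Sum>v\<in>V. card (neighbourhood E v)) = 2 * card E"
proof -
  have fV: "finite V" and sub: "\<And>e. e \<in> E \<Longrightarrow> e \<subseteq> V" and two: "\<And>e. e \<in> E \<Longrightarrow> card e = 2"
    using g by (auto simp: simple_graph_def)
  have fE: "finite E" using fV sub by (meson Pow_iff finite_Pow_iff finite_subset subsetI)
  \<comment> \<open>As a sum of indicators over the edges, the degree allows the two summations to
    be interchanged. The neighbours \<open>u\<close> of \<open>v\<close> correspond to the edges
    \<open>{v, u}\<close> through \<open>v\<close>.\<close>
  have "card (neighbourhood E v) = (\<Sum>e\<in>E. if v \<in> e then 1 else 0)" for v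
  proof -
    have "bij_betw (\<lambda>u. {v, u}) (neighbourhood E v) {e \<in> E. v \<in> e}"
      unfolding bij_betw_def
    proof
      show "inj_on (\<lambda>u. {v, u}) (neighbourhood E v)"
        by (auto simp: inj_on_def doubleton_eq_iff)
      show "(\<lambda>u. {v, u}) ` neighbourhood E v = {e \<in> E. v \<in> e}"
      proof
        show "{e \<in> E. v \<in> e} \<subseteq> (\<lambda>u. {v, u}) ` neighbourhood E v"
        proof
          fix e assume e: "e \<in> {e \<in> E. v \<in> e}"
          then obtain x y where "e = {x, y}" using two card_2_iff by (metis (no_types, lifting) mem_Collect_eq)
          with e obtain u where "e = {v, u}" by auto
          with e show "e \<in> (\<lambda>u. {v, u}) ` neighbourhood E v" by (auto simp: neighbourhood_def)
        qed
      qed (auto simp: neighbourhood_def)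
    qed
    then have "card (neighbourhood E v) = card {e \<in> E. v \<in> e}" by (rule bij_betw_same_card)
    then show ?thesis using fE by (simp add: sum.If_cases Int_def)
  qed
  then have "(\<Sum>v\<in>V. card (neighbourhood E v)) = (\<Sum>e\<in>E. \<Sum>v\<in>V. if v \<in> e then 1 else 0)"
    by (simp add: sum.swap[of _ E V])
  also have "\<dots> = (\<Sum>e\<in>E. card e)"
    using sub fV by (intro sum.cong) (auto simp: sum.If_cases Int_absorb1)
  also have "\<dots> = 2 * card E" using two by simp
  finally show ?thesis .
qed

text \<open>Each summand of the product is the indicator that \<open>vs ! k\<close> is a common
  neighbour, and \<open>vs\<close> runs through every vertex once. The case \<open>i = j\<close> is
  included: it yields the degree, which the trace and the diagonal of the decomposition
  require.\<close>

lemma adjacency_matrix_square: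
  assumes g: "simple_graph V E" and d: "distinct vs" and V: "set vs = V"
    and ij: "i < length vs" "j < length vs"
  shows "(adjacency_matrix E vs * adjacency_matrix E vs) $$ (i, j)
    = real (card (neighbourhood E (vs ! i) \<inter> neighbourhood E (vs ! j)))"
proof -
  let ?N = "neighbourhood E (vs ! i) \<inter> neighbourhood E (vs ! j)"
  have "(adjacency_matrix E vs * adjacency_matrix E vs) $$ (i, j)
    = (\<Sum>k<length vs. if vs ! k \<in> ?N then 1 else 0)"
    using ij by (subst index_mult_mat_sum[of _ "length vs" "length vs" _ "length vs"])
      (auto simp: adjacency_matrix_def neighbourhood_def insert_commute intro!: sum.cong)
  also have "\<dots> = (\<Sum>u\<in>V. if u \<in> ?N then 1 else 0)"
    by (rule sum.reindex_bij_betw) (use bij_betw_nth[OF d, of "{..<length vs}" V] V in auto)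
  also have "\<dots> = real (card ?N)"
    using neighbourhood_subset[OF g] V
    by (subst sum.If_cases) (auto simp: Int_absorb1 Int_def intro!: arg_cong[where f = card])
  finally show ?thesis .
qed

theorem theorem4p3:
  fixes V :: "'a set" and E :: "'a set set" and vs :: "'a list"
  assumes "simple_graph V E"
    and "distinct vs" and "set vs = V"
  shows "cn_energy E vs \<le> (graph_energy E vs)\<^sup>2 + 2 * real (card E)"
proof -
  define n where "n = length vs"
  define A where "A = adjacency_matrix E vs"
  define d where "d i = real (card (neighbourhood E (vs ! i)))" for i
  define Z where "Z = mat n n (\<lambda>(i, j). if i = j then sqrt (d i) else 0)"
  have A: "A \<in> carrier_mat n n" by (simp add: A_def adjacency_matrix_def n_def)
  have Z: "Z \<in> carrier_mat n n" by (simp add: Z_def)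
  have At: "transpose_mat A = A"
    by (intro eq_matI) (auto simp: A_def adjacency_matrix_def insert_commute)
  note sq = adjacency_matrix_square[OF assms, folded A_def n_def]
  have ZZ: "(transpose_mat Z * Z) $$ (i, j) = (if i = j then d i else 0)" if "i < n" "j < n" for i j
  proof -
    have "(transpose_mat Z * Z) $$ (i, j) = (\<Sum>l<n. transpose_mat Z $$ (i, l) * Z $$ (l, j))"
      using that Z by (intro index_mult_mat_sum) auto
    \<comment> \<open>\<open>Z\<close> is diagonal, so only \<open>l = i\<close> can contribute; the
      square root squares back to \<open>d i\<close> because a cardinality is nonnegative.\<close>
    also have "\<dots> = (\<Sum>l<n. if l = i then (if i = j then d i else 0) else 0)"
      using that by (intro sum.cong) (auto simp: Z_def d_def)
    finally show ?thesis using that by simp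
  qed
  \<comment> \<open>A vertex shares its whole neighbourhood with itself, so subtracting
    \<open>d i\<close> produces exactly the zero prescribed on the diagonal; the other entries are
    untouched.\<close>
  have CN: "common_neighbourhood_matrix E vs = transpose_mat A * A - transpose_mat Z * Z"
    unfolding At
  proof (rule eq_matI)
    fix i j assume "i < dim_row (A * A - Z\<^sup>T * Z)" "j < dim_col (A * A - Z\<^sup>T * Z)"
    then have "i < n" "j < n" using Z by auto
    then show "common_neighbourhood_matrix E vs $$ (i, j) = (A * A - Z\<^sup>T * Z) $$ (i, j)"
      using sq[of i j] ZZ[of i j] Z
      by (subst index_minus_mat) (auto simp: common_neighbourhood_matrix_def n_def d_def)
  qed (use Z in \<open>auto simp: common_neighbourhood_matrix_def n_def\<close>)
  have deg: "(\<Sum>i<n. d i) = 2 * real (card E)"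
  proof -
    have "(\<Sum>i<n. d i) = (\<Sum>v\<in>V. real (card (neighbourhood E v)))"
      unfolding d_def
      by (rule sum.reindex_bij_betw)
        (use bij_betw_nth[OF assms(2), of "{..<n}" V] assms(3) in \<open>auto simp: n_def\<close>)
    also have "\<dots> = 2 * real (card E)"
      using sum_degrees[OF assms(1)] by (metis of_nat_mult of_nat_numeral of_nat_sum)
    finally show ?thesis .
  qed
  have trA: "mat_trace (A * A) = 2 * real (card E)"
    using A sq by (simp add: mat_trace_def d_def flip: deg)
  have trZ: "mat_trace (transpose_mat Z * Z) = 2 * real (card E)"
    using Z ZZ by (simp add: mat_trace_def flip: deg del: index_mult_mat(1))
  have "cn_energy E vs \<le> mat_trace (A * A) + mat_trace (transpose_mat Z * Z)"
    using matrix_energy_gram_diff_le[OF A Z] by (simp add: cn_energy_def CN At)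
  \<comment> \<open>The two traces are equal but are treated differently: that of
    \<open>A * A\<close> is replaced by the squared energy, the other remains as twice the number of
    edges.\<close>
  also have "\<dots> \<le> (graph_energy E vs)\<^sup>2 + 2 * real (card E)"
    using trace_square_le_matrix_energy[OF A] by (simp add: trZ graph_energy_def A_def)
  finally show ?thesis .
qed

end
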